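(* Let $k$ be a positive integer with $k \equiv 7 \pmod{15}$ and let \[ n = L_{CC}(10,k) = \frac{512k^5+1280k^4+6080k^3+7840k^2+10010k+3741}{3125}. \] Then there is an undirected Cayley graph of the cyclic group $\mathbb{Z}_n$ on five generators which has diameter $k$. Moreover, a generating set for such a graph is \[ \Big\{1,\ \tfrac{128k^4+256k^3+1192k^2+1064k+883}{625},\ \tfrac{512k^5+640k^4+3200k^3-2520k^2-8510k-12624}{9375},\ \tfrac{512k^5+640k^4+5600k^3+1080k^2+4540k-6699}{9375},\ \tfrac{512k^5+640k^4+5600k^3+1080k^2+12040k-2949}{9375}\Big\}, \] i.e. the Cayley graph of $\mathbb{Z}_n$ with connection set $\{\pm g_1,\dots,\pm g_5\}$, where $g_1,\dots,g_5$ are these integers taken modulo $n$, has diameter $k$.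
   Context: For a positive integer $n$ and integers $g_1,\dots,g_5$, the undirected Cayley (circulant) graph of the cyclic group $\mathbb{Z}_n$ with generating set $\{g_1,\dots,g_5\}$ has vertex set $\mathbb{Z}_n$, with $i$ and $j$ adjacent if and only if $j-i \equiv \pm g_t \pmod n$ for some $t$. Its diameter is the maximum over pairs of vertices of the graph distance. The notation $L_{CC}(10,k)$ is just a name for the displayed polynomial value. *)

theory Defs
  imports "Graph_Theory.Graph_Theory" "HOL-Number_Theory.Cong"
begin

text \<open>The vertices \<open>{0..<n}\<close> are the canonical representatives of \<open>\<int>\<^sub>n\<close>. An undirected graph is
  encoded, as usual in this library, as a symmetric digraph. The elements of \<open>S\<close> are arbitrary
  integers and matter only modulo \<open>n\<close>.\<close>

definition circulant_graph :: "int \<Rightarrow> int set \<Rightarrow> (int, int \<times> int) pre_digraph" where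
  "circulant_graph n S =
    \<lparr> verts = {0..<n},
      arcs = {(i, j). i \<in> {0..<n} \<and> j \<in> {0..<n} \<and>
                (\<exists>g\<in>S. [j - i = g] (mod n) \<or> [j - i = - g] (mod n))},
      tail = fst, head = snd \<rparr>"

lemma pseudo_graph_circulant_graph: "pseudo_graph (circulant_graph n S)"
proof
  show "finite (arcs (circulant_graph n S))"
    by (rule finite_subset[of _ "{0..<n} \<times> {0..<n}"]) (auto simp: circulant_graph_def)
  have "[i - j = - g] (mod n)" if "[j - i = g] (mod n)" for i j g :: int
    using cong_minus_minus_iff[of "j - i" g n] that by simp
  moreover have "[i - j = g] (mod n)" if "[j - i = - g] (mod n)" for i j g :: int
    using cong_minus_minus_iff[of "j - i" "- g" n] that by simp
  ultimately show "symmetric (circulant_graph n S)"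
    by (fastforce simp: symmetric_conv circulant_graph_def)
qed (auto simp: circulant_graph_def)

text \<open>The distance is the minimal cost of a walk when every arc costs 1; it is \<open>\<infinity>\<close> when there is no
  walk, so a finite diameter includes connectedness. For a finite nonempty vertex set the
  supremum is a maximum.\<close>

definition graph_dist :: "('a, 'b) pre_digraph \<Rightarrow> 'a \<Rightarrow> 'a \<Rightarrow> ereal" where
  "graph_dist G u v = wf_digraph.\<mu> G (\<lambda>_. 1) u v"

definition diameter :: "('a, 'b) pre_digraph \<Rightarrow> ereal" where
  "diameter G = (SUP (u, v) \<in> verts G \<times> verts G. graph_dist G u v)"

text \<open>The order and the generators are given by rational expressions; that they take integer values
  at the relevant \<open>k\<close> is part of what is claimed, hence the type \<open>rat\<close>.\<close>

definition L_CC_10 :: "rat \<Rightarrow> rat" where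
  "L_CC_10 k = (512*k^5 + 1280*k^4 + 6080*k^3 + 7840*k^2 + 10010*k + 3741) / 3125"

definition gen2 :: "rat \<Rightarrow> rat" where
  "gen2 k = (128*k^4 + 256*k^3 + 1192*k^2 + 1064*k + 883) / 625"

definition gen3 :: "rat \<Rightarrow> rat" where
  "gen3 k = (512*k^5 + 640*k^4 + 3200*k^3 - 2520*k^2 - 8510*k - 12624) / 9375"

definition gen4 :: "rat \<Rightarrow> rat" where
  "gen4 k = (512*k^5 + 640*k^4 + 5600*k^3 + 1080*k^2 + 4540*k - 6699) / 9375"

definition gen5 :: "rat \<Rightarrow> rat" where
  "gen5 k = (512*k^5 + 640*k^4 + 5600*k^3 + 1080*k^2 + 12040*k - 2949) / 9375"

end

theory Submission
  imports Defs "HOL-Library.Function_Algebras" "HOL-Library.Cardinality"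
begin

text \<open>
  Write \<open>2 k + 1 = 5 h\<close>. The vectors \<open>x \<in> \<int>\<^sup>5\<close> with \<open>x\<^sub>1 g\<^sub>1 + \<dots> + x\<^sub>5 g\<^sub>5 \<equiv> 0 (mod n)\<close> form a lattice \<open>L\<close>,
  and the diameter is the covering radius of \<open>L\<close> in the \<open>\<ell>\<^sub>1\<close> norm. The lattice is a slightly twisted
  body-centred cubic lattice: there is an antisymmetric matrix \<open>A\<close> such that \<open>L\<close> consists of the
  vectors \<open>s E / 2\<close> with \<open>E = 2 h I + A\<close> and \<open>s\<close> an integer vector whose entries are all even or all odd.
  The nonzero entries of \<open>A\<close> are \<open>\<plusminus>1\<close> and form a bowtie, two triangles with a common vertex.

  \<^emph>\<open>Upper bound.\<close> For a sign vector \<open>s\<close>, antisymmetry gives \<open>s E / 2\<close> the norm \<open>5 h = 2 k + 1\<close>, so a point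
  of the box spanned by \<open>0\<close> and \<open>s E / 2\<close> is within \<open>k\<close> of one of these two corners. Every coset of the
  row lattice of \<open>E\<close> meets one of the boxes: if \<open>x\<close> leaves the box of its orthant in direction \<open>i\<close>,
  then subtracting \<open>\<plusminus>e\<^sub>i E\<close> decreases the norm. This fails only for points with coordinates near \<open>0\<close>,
  which is repaired by minimising a norm that penalises zero coordinates.

  \<^emph>\<open>Lower bound.\<close> If \<open>s\<close> is odd, then \<open>s E / 2\<close> has norm at least \<open>5 h\<close>, so it is at distance at least \<open>k + 1\<close>
  from every point of norm \<open>k\<close>. If moreover the coordinates of such a point are smaller than \<open>h\<close> by
  enough to absorb \<open>A\<close>, then no row combination of \<open>E\<close> is closer to it than \<open>0\<close>.
\<close>

section \<open>Twisted body-centred cubic lattices\<close>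

definition l1_norm :: "('i::finite \<Rightarrow> int) \<Rightarrow> int" where
  "l1_norm x = (\<Sum>i\<in>UNIV. \<bar>x i\<bar>)"

definition antisymmetric :: "('i \<Rightarrow> 'i \<Rightarrow> int) \<Rightarrow> bool" where
  "antisymmetric A \<longleftrightarrow> (\<forall>i j. A j i = - A i j)"

definition abs_row_sum :: "('i::finite \<Rightarrow> 'i \<Rightarrow> int) \<Rightarrow> 'i \<Rightarrow> int" where
  "abs_row_sum A i = (\<Sum>j\<in>UNIV. \<bar>A i j\<bar>)"

text \<open>The row vector \<open>s (2 h I + A)\<close>.\<close>
definition edge_combination ::
    "int \<Rightarrow> ('i \<Rightarrow> 'i \<Rightarrow> int) \<Rightarrow> ('i::finite \<Rightarrow> int) \<Rightarrow> 'i \<Rightarrow> int" where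
  "edge_combination h A s i = 2 * h * s i + (\<Sum>j\<in>UNIV. s j * A j i)"

definition twisted_bcc_lattice ::
    "int \<Rightarrow> ('i \<Rightarrow> 'i \<Rightarrow> int) \<Rightarrow> ('i::finite \<Rightarrow> int) set" where
  "twisted_bcc_lattice h A =
    {v. \<exists>s. (\<forall>i j. even (s i - s j)) \<and> (\<forall>i. 2 * v i = edge_combination h A s i)}"

lemma antisymmetricD: "antisymmetric A \<Longrightarrow> A j i = - A i j"
  unfolding antisymmetric_def by blast

lemma l1_norm_diff_ge: "l1_norm v - l1_norm w \<le> l1_norm (w - v)"
  unfolding l1_norm_def sum_subtractf[symmetric] by (rule sum_mono) simp

lemma edge_combination_add:
  "edge_combination h A (s + t) = edge_combination h A s + edge_combination h A t"
  by (rule ext) (simp add: edge_combination_def sum.distrib distrib_left distrib_right)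

lemma edge_combination_uminus: "edge_combination h A (- s) = - edge_combination h A s"
  by (rule ext) (simp add: edge_combination_def sum_negf)

lemma edge_combination_double:
  "edge_combination h A (\<lambda>i. 2 * s i) i = 2 * edge_combination h A s i"
  by (simp add: edge_combination_def sum_distrib_left distrib_left mult.assoc mult.left_commute)

lemma sum_mult_edge_combination_self:
  fixes s :: "'i::finite \<Rightarrow> int"
  assumes "antisymmetric A"
  shows "(\<Sum>i\<in>UNIV. s i * edge_combination h A s i) = 2 * h * (\<Sum>i\<in>UNIV. s i * s i)"
proof -
  define Q where "Q = (\<Sum>i\<in>UNIV. \<Sum>j\<in>UNIV. s i * s j * A j i)"
  have "Q = (\<Sum>i\<in>UNIV. \<Sum>j\<in>UNIV. s j * s i * A i j)"
    unfolding Q_def by (rule sum.swap)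
  also have "s j * s i * A i j = - (s i * s j * A j i)" for i j
    using antisymmetricD[OF assms, of j i] by simp
  then have "(\<Sum>i\<in>UNIV. \<Sum>j\<in>UNIV. s j * s i * A i j) = - Q"
    unfolding Q_def sum_negf[symmetric] by (intro sum.cong refl)
  finally have "Q = 0" by simp
  have "(\<Sum>i\<in>UNIV. s i * edge_combination h A s i) = (\<Sum>i\<in>UNIV. 2 * h * (s i * s i)) + Q"
    unfolding Q_def sum.distrib[symmetric]
    by (rule sum.cong) (simp_all add: edge_combination_def distrib_left sum_distrib_left ac_simps)
  with \<open>Q = 0\<close> show ?thesis
    by (simp add: sum_distrib_left)
qed

lemma sum_mult_edge_combination_signs:
  fixes s :: "'i::finite \<Rightarrow> int"
  assumes "antisymmetric A" and "\<And>i. s i \<in> {1, -1}"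
  shows "(\<Sum>i\<in>UNIV. s i * edge_combination h A s i) = 2 * (h * int CARD('i))"
proof -
  have "s i * s i = 1" for i
    using assms(2)[of i] by auto
  then show ?thesis
    by (simp add: sum_mult_edge_combination_self[OF assms(1)])
qed

lemma sum_abs_row_combination_le:
  fixes s :: "'i::finite \<Rightarrow> int"
  shows "(\<Sum>i\<in>UNIV. \<bar>\<Sum>j\<in>UNIV. s j * A j i\<bar>) \<le> (\<Sum>j\<in>UNIV. \<bar>s j\<bar> * abs_row_sum A j)"
proof -
  have "(\<Sum>i\<in>UNIV. \<bar>\<Sum>j\<in>UNIV. s j * A j i\<bar>) \<le> (\<Sum>i\<in>UNIV. \<Sum>j\<in>UNIV. \<bar>s j * A j i\<bar>)"
    by (intro sum_mono sum_abs)
  also have "\<dots> = (\<Sum>j\<in>UNIV. \<Sum>i\<in>UNIV. \<bar>s j * A j i\<bar>)"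
    by (rule sum.swap)
  also have "\<dots> = (\<Sum>j\<in>UNIV. \<bar>s j\<bar> * abs_row_sum A j)"
    by (simp add: abs_row_sum_def abs_mult sum_distrib_left)
  finally show ?thesis .
qed

section \<open>A point far from the lattice\<close>

lemma l1_norm_le_l1_norm_diff_edge_combination:
  fixes w d :: "'i::finite \<Rightarrow> int"
  assumes small: "\<And>i. 2 * \<bar>w i\<bar> + abs_row_sum A i \<le> 2 * h"
  shows "l1_norm w \<le> l1_norm (w - edge_combination h A d)"
proof -
  have shift: "\<bar>w i\<bar> + \<bar>d i\<bar> * abs_row_sum A i \<le> \<bar>w i - 2 * h * d i\<bar>" for i
  proof (cases "d i = 0")
    case False
    have "\<bar>w i\<bar> * 1 \<le> \<bar>w i\<bar> * \<bar>d i\<bar>"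
      using False by (intro mult_left_mono) auto
    moreover have "\<bar>d i\<bar> * (2 * \<bar>w i\<bar> + abs_row_sum A i) \<le> \<bar>d i\<bar> * \<bar>2 * h\<bar>"
      using small[of i] by (intro mult_left_mono) auto
    ultimately have "\<bar>w i\<bar> + \<bar>d i\<bar> * abs_row_sum A i \<le> \<bar>2 * h * d i\<bar> - \<bar>w i\<bar>"
      by (simp add: abs_mult algebra_simps)
    then show ?thesis by linarith
  qed simp
  have "l1_norm w + (\<Sum>i\<in>UNIV. \<bar>d i\<bar> * abs_row_sum A i) \<le> (\<Sum>i\<in>UNIV. \<bar>w i - 2 * h * d i\<bar>)"
    unfolding l1_norm_def sum.distrib[symmetric] by (intro sum_mono shift)
  also have "\<dots> \<le> (\<Sum>i\<in>UNIV. \<bar>(w - edge_combination h A d) i\<bar> + \<bar>\<Sum>j\<in>UNIV. d j * A j i\<bar>)"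
    by (intro sum_mono) (simp add: edge_combination_def)
  also have "\<dots> \<le> l1_norm (w - edge_combination h A d) + (\<Sum>i\<in>UNIV. \<bar>d i\<bar> * abs_row_sum A i)"
    using sum_abs_row_combination_le[of d A] by (simp add: l1_norm_def sum.distrib)
  finally show ?thesis by simp
qed

lemma sum_mult_edge_combination_nonneg:
  fixes s t :: "'i::finite \<Rightarrow> int"
  assumes "\<And>i. abs_row_sum A i \<le> 2 * h" and "\<And>i. \<bar>t i\<bar> \<le> 1" and "\<And>i. t i * s i = \<bar>s i\<bar>"
  shows "0 \<le> (\<Sum>i\<in>UNIV. t i * edge_combination h A s i)"
proof -
  have "0 \<le> (\<Sum>i\<in>UNIV. \<bar>s i\<bar> * (2 * h - abs_row_sum A i))"
    using assms(1) by (simp add: sum_nonneg)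
  also have "\<dots> = (\<Sum>i\<in>UNIV. 2 * h * \<bar>s i\<bar>) - (\<Sum>i\<in>UNIV. \<bar>s i\<bar> * abs_row_sum A i)"
    by (simp add: sum_subtractf[symmetric] algebra_simps)
  also have "\<dots> \<le> (\<Sum>i\<in>UNIV. 2 * h * \<bar>s i\<bar>) - (\<Sum>i\<in>UNIV. \<bar>\<Sum>j\<in>UNIV. s j * A j i\<bar>)"
    using sum_abs_row_combination_le[of s A] by simp
  also have "\<dots> \<le> (\<Sum>i\<in>UNIV. t i * edge_combination h A s i)"
    unfolding sum_subtractf[symmetric]
  proof (rule sum_mono)
    fix i
    define e where "e = (\<Sum>j\<in>UNIV. s j * A j i)"
    have "\<bar>t i * e\<bar> \<le> \<bar>e\<bar>"
      using mult_right_mono[OF assms(2)[of i], of "\<bar>e\<bar>"] by (simp add: abs_mult)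
    moreover have "t i * edge_combination h A s i = 2 * h * \<bar>s i\<bar> + t i * e"
      by (simp add: edge_combination_def e_def assms(3)[symmetric] algebra_simps)
    ultimately show "2 * h * \<bar>s i\<bar> - \<bar>\<Sum>j\<in>UNIV. s j * A j i\<bar> \<le> t i * edge_combination h A s i"
      by (simp add: e_def)
  qed
  finally show ?thesis .
qed

lemma mult_card_le_l1_norm_half_edge_combination:
  fixes s v :: "'i::finite \<Rightarrow> int"
  assumes A: "antisymmetric A" "\<And>i. abs_row_sum A i \<le> 2 * h"
    and nonzero: "\<And>i. s i \<noteq> 0" and v: "\<And>i. 2 * v i = edge_combination h A s i"
  shows "h * int CARD('i) \<le> l1_norm v"
proof -
  define t where "t = (\<lambda>i. sgn (s i))"
  have t: "t i \<in> {1, -1}" "\<bar>t i\<bar> \<le> 1" "t i * (s - t) i = \<bar>(s - t) i\<bar>" for i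
    using nonzero[of i] by (auto simp: t_def sgn_if)
  have "s = t + (s - t)"
    by simp
  then have s: "edge_combination h A s i =
      edge_combination h A t i + edge_combination h A (s - t) i" for i
    using edge_combination_add[of h A t "s - t"] by (metis plus_fun_apply)
  have "2 * (h * int CARD('i)) = (\<Sum>i\<in>UNIV. t i * edge_combination h A t i)"
    using sum_mult_edge_combination_signs[OF A(1) t(1)] by simp
  also have "\<dots> \<le> (\<Sum>i\<in>UNIV. t i * edge_combination h A s i)"
    using sum_mult_edge_combination_nonneg[where t = t and s = "s - t", OF A(2) t(2,3)]
    by (simp add: s distrib_left sum.distrib)
  also have "t i * edge_combination h A s i \<le> 2 * \<bar>v i\<bar>" for i
    using t(1)[of i] by (auto simp: v[symmetric])
  then have "(\<Sum>i\<in>UNIV. t i * edge_combination h A s i) \<le> (\<Sum>i\<in>UNIV. 2 * \<bar>v i\<bar>)"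
    by (rule sum_mono)
  also have "\<dots> = 2 * l1_norm v"
    by (simp add: l1_norm_def sum_distrib_left)
  finally show ?thesis by simp
qed

theorem l1_norm_le_l1_norm_diff_twisted_bcc_lattice:
  fixes w v :: "'i::finite \<Rightarrow> int"
  assumes A: "antisymmetric A"
    and small: "\<And>i. 2 * \<bar>w i\<bar> + abs_row_sum A i \<le> 2 * h"
    and norm: "2 * l1_norm w \<le> h * int CARD('i)"
    and "v \<in> twisted_bcc_lattice h A"
  shows "l1_norm w \<le> l1_norm (w - v)"
proof -
  obtain s where parity: "\<And>i j. even (s i - s j)"
    and v: "\<And>i. 2 * v i = edge_combination h A s i"
    using assms(4) by (auto simp: twisted_bcc_lattice_def)
  show ?thesis
  proof (cases "\<forall>i. even (s i)")
    case True
    then have "s = (\<lambda>i. 2 * (s i div 2))"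
      by (simp add: fun_eq_iff)
    then have "v = edge_combination h A (\<lambda>i. s i div 2)"
      using v edge_combination_double[of h A "\<lambda>i. s i div 2"]
      by (metis ext mult_left_cancel zero_neq_numeral)
    then show ?thesis
      using l1_norm_le_l1_norm_diff_edge_combination[OF small] by simp
  next
    case False
    then obtain j where "odd (s j)" by blast
    then have "s i \<noteq> 0" for i
      using parity[of i j] by auto
    moreover have "abs_row_sum A i \<le> 2 * h" for i
      using small[of i] by simp
    ultimately have "h * int CARD('i) \<le> l1_norm v"
      using mult_card_le_l1_norm_half_edge_combination[OF A] v by blast
    then show ?thesis
      using norm l1_norm_diff_ge[of v w] by linarith
  qed
qed

section \<open>Boxes between lattice points\<close>

definition in_sign_box ::
    "int \<Rightarrow> ('i \<Rightarrow> 'i \<Rightarrow> int) \<Rightarrow> ('i::finite \<Rightarrow> int) \<Rightarrow> ('i \<Rightarrow> int) \<Rightarrow> bool" where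
  "in_sign_box h A s x \<longleftrightarrow>
    (\<forall>i. s i \<in> {1, -1} \<and> 0 \<le> s i * x i \<and> 2 * (s i * x i) \<le> s i * edge_combination h A s i)"

lemma in_sign_box_iff:
  "in_sign_box h A s x \<longleftrightarrow> (\<forall>i. s i \<in> {1, -1} \<and> 0 \<le> s i * x i \<and>
    2 * (s i * x i) \<le> 2 * h + s i * (\<Sum>j\<in>UNIV. s j * A j i))"
proof -
  have "s i * edge_combination h A s i = 2 * h + s i * (\<Sum>j\<in>UNIV. s j * A j i)"
    if "s i \<in> {1, -1}" for i
    using that by (auto simp: edge_combination_def)
  then show ?thesis
    unfolding in_sign_box_def by (intro all_cong1 conj_cong refl) simp
qed

lemma in_sign_box_uminus: "in_sign_box h A s (- x) \<Longrightarrow> in_sign_box h A (- s) x"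
  by (auto simp: in_sign_box_def edge_combination_uminus)

lemma l1_norm_corners_of_sign_box:
  fixes s v x :: "'i::finite \<Rightarrow> int"
  assumes A: "antisymmetric A" and box: "in_sign_box h A s x"
    and v: "\<And>i. 2 * v i = edge_combination h A s i"
  shows "l1_norm x + l1_norm (x - v) = h * int CARD('i)"
proof -
  have signs: "s i \<in> {1, -1}" for i
    using box by (simp add: in_sign_box_def)
  have "2 * (\<bar>x i\<bar> + \<bar>(x - v) i\<bar>) = s i * edge_combination h A s i" for i
    using box[unfolded in_sign_box_def, rule_format, of i] by (auto simp: v[symmetric])
  then have "2 * (l1_norm x + l1_norm (x - v)) = (\<Sum>i\<in>UNIV. s i * edge_combination h A s i)"
    unfolding l1_norm_def sum.distrib[symmetric] sum_distrib_left by simp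
  then show ?thesis
    using sum_mult_edge_combination_signs[OF A signs] by simp
qed

lemma ex_lattice_point_near_sign_box:
  fixes x :: "'i::finite \<Rightarrow> int"
  assumes A: "antisymmetric A" "\<And>i. even (abs_row_sum A i)"
    and box: "in_sign_box h A s (x - edge_combination h A d)"
    and k: "h * int CARD('i) \<le> 2 * k + 1"
  shows "\<exists>v\<in>twisted_bcc_lattice h A. l1_norm (x - v) \<le> k"
proof -
  have odd: "odd (s i)" for i
    using box[unfolded in_sign_box_def, rule_format, of i] by auto
  have "even (edge_combination h A s i)" for i
  proof -
    have "odd (s j * A j i) \<longleftrightarrow> odd \<bar>A i j\<bar>" for j
      using odd antisymmetricD[OF A(1), of j i] by simp
    then have "even (\<Sum>j\<in>UNIV. s j * A j i) \<longleftrightarrow> even (\<Sum>j\<in>UNIV. \<bar>A i j\<bar>)"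
      by (simp only: even_sum_iff[OF finite])
    then show ?thesis
      using A(2) by (simp add: edge_combination_def abs_row_sum_def)
  qed
  then obtain v where v: "\<And>i. 2 * v i = edge_combination h A s i"
    by (intro that[of "\<lambda>i. edge_combination h A s i div 2"]) simp
  define y u where "y = x - edge_combination h A d" and "u = (\<lambda>i. 2 * d i)"
  have "edge_combination h A d \<in> twisted_bcc_lattice h A"
    unfolding twisted_bcc_lattice_def
    by (intro CollectI exI[of _ u]) (simp add: u_def edge_combination_double)
  moreover have "edge_combination h A d + v \<in> twisted_bcc_lattice h A"
    unfolding twisted_bcc_lattice_def
    by (intro CollectI exI[of _ "u + s"])
      (use odd v in \<open>simp add: edge_combination_add u_def edge_combination_double\<close>)
  moreover have "l1_norm y \<le> k \<or> l1_norm (y - v) \<le> k"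
    using l1_norm_corners_of_sign_box[OF A(1) box v] k unfolding y_def by linarith
  ultimately show ?thesis
    unfolding y_def diff_diff_eq by blast
qed

section \<open>Minimising a norm that penalises zero coordinates\<close>

definition bump :: "int \<Rightarrow> int \<Rightarrow> int" where
  "bump c x = (if x = 0 then c else 3 * \<bar>x\<bar>)"

definition bump_diff :: "int \<Rightarrow> int \<Rightarrow> int \<Rightarrow> int" where
  "bump_diff c e x = bump c (x - e) - bump c x"

definition penalised_norm :: "('i::finite \<Rightarrow> int) \<Rightarrow> ('i \<Rightarrow> int) \<Rightarrow> int" where
  "penalised_norm c x = (\<Sum>i\<in>UNIV. bump (c i) (x i))"

lemma bump_diff_0: "bump_diff c 0 x = 0"
  by (simp add: bump_diff_def)

lemma bump_diff_1:
  "bump_diff c 1 x = (if x \<le> -1 then 3 else if x = 0 then 3 - c else if x = 1 then c - 3 else -3)"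
  by (simp add: bump_diff_def bump_def)

lemma bump_diff_le: "\<lbrakk>0 \<le> c; c \<le> 3\<rbrakk> \<Longrightarrow> bump_diff c e x \<le> 3 * \<bar>e\<bar>"
  using abs_triangle_ineq4[of x e] by (cases "x = 0"; cases "x = e") (simp_all add: bump_diff_def bump_def)

lemma bump_uminus: "bump c (- x) = bump c x"
  by (simp add: bump_def)

lemma bump_diff_minus_1: "bump_diff c (- 1) x = bump_diff c 1 (- x)"
  using bump_uminus[of c x] bump_uminus[of c "x + 1"] by (simp add: bump_diff_def)

lemma penalised_norm_uminus: "penalised_norm c (- x) = penalised_norm c x"
  by (simp add: penalised_norm_def bump_uminus)

lemma ex_penalised_norm_minimal:
  assumes "\<And>i. 0 \<le> c i"
  shows "\<exists>d. \<forall>e. penalised_norm c (x - edge_combination h A d) \<le>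
    penalised_norm c (x - edge_combination h A d - edge_combination h A e)"
proof -
  have nonneg: "0 \<le> penalised_norm c y" for y
    unfolding penalised_norm_def bump_def using assms by (intro sum_nonneg) simp
  obtain d where "\<And>e. nat (penalised_norm c (x - edge_combination h A d)) \<le>
      nat (penalised_norm c (x - edge_combination h A e))"
    using ex_has_least_nat[of "\<lambda>_. True" 0 "\<lambda>d. nat (penalised_norm c (x - edge_combination h A d))"]
    by blast
  then have "penalised_norm c (x - edge_combination h A d) \<le>
      penalised_norm c (x - edge_combination h A (d + e))" for e
    using nonneg by (metis nat_le_eq_zle)
  then show ?thesis
    unfolding edge_combination_add diff_diff_eq[symmetric] by blast
qed

lemma coordinate_le_of_bump_le:
  assumes "0 < h" "0 < c" "b + c < 6 * h" "bump c x \<le> bump c (x - 2 * h) + b"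
  shows "6 * x \<le> 6 * h + b"
proof -
  consider "x = 0" | "x < 0" | "0 < x" "x < 2 * h" | "x = 2 * h" | "2 * h < x"
    by linarith
  then show ?thesis
    using assms by cases (simp_all add: bump_def)
qed

lemma coordinate_le_of_penalised_norm_minimal:
  fixes x :: "'i::finite \<Rightarrow> int"
  assumes A: "antisymmetric A" and h: "0 < h"
    and c: "\<And>i. 0 < c i" "\<And>i. c i \<le> 3" "\<And>i. 3 * abs_row_sum A i + c i < 6 * h"
    and minimal: "\<And>e. penalised_norm c x \<le> penalised_norm c (x - edge_combination h A e)"
  shows "6 * x i \<le> 6 * h + (\<Sum>j\<in>UNIV. bump_diff (c j) (A i j) (x j))"
proof (rule coordinate_le_of_bump_le)
  have A_diag: "A i i = 0"
    using antisymmetricD[OF A, of i i] by simp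
  define e :: "'i \<Rightarrow> int" where "e = (\<lambda>j. of_bool (j = i))"
  have e: "edge_combination h A e j = (if j = i then 2 * h else A i j)" for j
    using A_diag by (simp add: e_def edge_combination_def)
  note split = sum.remove[OF finite UNIV_I, of _ i]
  have "bump (c i) (x i) + (\<Sum>j\<in>UNIV - {i}. bump (c j) (x j)) \<le>
      bump (c i) (x i - 2 * h) + (\<Sum>j\<in>UNIV - {i}. bump (c j) (x j - A i j))"
    using minimal[of e] unfolding penalised_norm_def split by (simp add: e)
  moreover have "(\<Sum>j\<in>UNIV. bump_diff (c j) (A i j) (x j)) =
      (\<Sum>j\<in>UNIV - {i}. bump (c j) (x j - A i j)) - (\<Sum>j\<in>UNIV - {i}. bump (c j) (x j))"
    unfolding split using A_diag by (simp add: bump_diff_def sum_subtractf)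
  ultimately show "bump (c i) (x i) \<le>
      bump (c i) (x i - 2 * h) + (\<Sum>j\<in>UNIV. bump_diff (c j) (A i j) (x j))"
    by linarith
  have "(\<Sum>j\<in>UNIV. bump_diff (c j) (A i j) (x j)) \<le> 3 * abs_row_sum A i"
    unfolding abs_row_sum_def sum_distrib_left
    by (intro sum_mono bump_diff_le) (use c in \<open>auto intro: less_imp_le\<close>)
  then show "(\<Sum>j\<in>UNIV. bump_diff (c j) (A i j) (x j)) + c i < 6 * h"
    using c(3)[of i] by linarith
qed (rule h c)+

lemma ex_translate_coordinate_bounds:
  fixes x :: "'i::finite \<Rightarrow> int"
  assumes A: "antisymmetric A" and h: "0 < h"
    and c: "\<And>i. 0 < c i" "\<And>i. c i \<le> 3" "\<And>i. 3 * abs_row_sum A i + c i < 6 * h"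
  obtains y d where "y = x - edge_combination h A d"
    and "\<And>i. 6 * y i \<le> 6 * h + (\<Sum>j\<in>UNIV. bump_diff (c j) (A i j) (y j))"
    and "\<And>i. 6 * - y i \<le> 6 * h + (\<Sum>j\<in>UNIV. bump_diff (c j) (A i j) (- y j))"
proof -
  obtain d where minimal: "\<And>e. penalised_norm c (x - edge_combination h A d) \<le>
      penalised_norm c (x - edge_combination h A d - edge_combination h A e)"
    using ex_penalised_norm_minimal[of c x h A] less_imp_le[OF c(1)] by blast
  define y where "y = x - edge_combination h A d"
  have minimal_y: "penalised_norm c y \<le> penalised_norm c (y - edge_combination h A e)" for e
    unfolding y_def by (rule minimal)
  have minimal_uminus_y:
    "penalised_norm c (- y) \<le> penalised_norm c (- y - edge_combination h A e)" for e
    using minimal_y[of "- e"] penalised_norm_uminus[of c y]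
      penalised_norm_uminus[of c "y + edge_combination h A e"]
    by (simp add: edge_combination_uminus)
  note bound = coordinate_le_of_penalised_norm_minimal[OF A h c]
  show thesis
    using that[OF y_def] bound[OF minimal_y] bound[OF minimal_uminus_y] by simp
qed

section \<open>The bowtie\<close>

datatype vertex = V1 | V2 | V3 | V4 | V5

abbreviation vec5 :: "'a \<Rightarrow> 'a \<Rightarrow> 'a \<Rightarrow> 'a \<Rightarrow> 'a \<Rightarrow> vertex \<Rightarrow> 'a" where
  "vec5 \<equiv> case_vertex"

lemma UNIV_vertex: "UNIV = {V1, V2, V3, V4, V5}"
proof -
  have "i \<in> {V1, V2, V3, V4, V5}" for i
    by (cases i) simp_all
  then show ?thesis by blast
qed

instance vertex :: finite
  by standard (simp add: UNIV_vertex)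

lemma card_vertex: "CARD(vertex) = 5"
  by (simp add: UNIV_vertex)

lemma sum_vertex: "(\<Sum>i\<in>UNIV. f i) = f V1 + (f V2 + (f V3 + (f V4 + f V5)))"
  by (simp add: UNIV_vertex)

lemma all_vertex: "(\<forall>i. P i) \<longleftrightarrow> P V1 \<and> P V2 \<and> P V3 \<and> P V4 \<and> P V5"
  using vertex.induct[of P] by blast

lemma range_vertex: "range f = {f V1, f V2, f V3, f V4, f V5}"
  by (simp add: UNIV_vertex)

text \<open>The triangles are \<open>{V1, V4, V5}\<close> and \<open>{V2, V3, V4}\<close>.\<close>
definition bowtie :: "vertex \<Rightarrow> vertex \<Rightarrow> int" where
  "bowtie = vec5
    (vec5   0    0    0  1 (-1))
    (vec5   0    0  (-1) 1   0)
    (vec5   0    1    0  1   0)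
    (vec5 (-1) (-1) (-1) 0 (-1))
    (vec5   1    0    0  1   0)"

lemma antisymmetric_bowtie: "antisymmetric bowtie"
  by (simp add: antisymmetric_def all_vertex bowtie_def)

lemma abs_row_sum_bowtie: "abs_row_sum bowtie = vec5 2 2 2 4 2"
  by (simp add: fun_eq_iff all_vertex abs_row_sum_def sum_vertex bowtie_def)

text \<open>
  The weights make the slopes of \<^const>\<open>bump\<close> near \<open>0\<close> differ from \<open>\<plusminus>3\<close> by so little that the errors add
  up to at most \<open>5\<close>, which the integrality of the box bounds absorbs.
\<close>
definition bowtie_weight :: "vertex \<Rightarrow> int" where
  "bowtie_weight = vec5 1 1 1 2 1"

lemma double_sign_mult_le_of_six_mult_le:
  fixes a e h s :: int
  assumes "even e" "\<bar>e\<bar> \<le> 2 * h"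
    and "0 < a \<Longrightarrow> s = 1" "6 * a \<le> 6 * h + 3 * e + 5"
    and "a < 0 \<Longrightarrow> s = -1" "6 * - a \<le> 6 * h - 3 * e + 5"
    and "s \<in> {1, -1}"
  shows "2 * (s * a) \<le> 2 * h + s * e"
proof -
  have "2 * a \<le> 2 * h + e" "2 * - a \<le> 2 * h - e"
    using assms(1,4,6) by presburger+
  then show ?thesis
    using assms(2,3,5,7) by (cases a "0 :: int" rule: linorder_cases) auto
qed

text \<open>
  The signs \<open>s\<close> of \<open>y\<close> and \<open>t\<close> of \<open>z\<close> put these two coordinates of a triangle into a sign box in which
  the centre \<open>w\<close> of the bowtie has the sign \<open>1\<close>; the last condition leaves enough room for \<open>w\<close>.
\<close>
definition triangle_signs :: "int \<Rightarrow> int \<Rightarrow> int \<Rightarrow> int \<Rightarrow> int \<Rightarrow> int \<Rightarrow> bool" where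
  "triangle_signs h w y z s t \<longleftrightarrow> s \<in> {1, -1} \<and> t \<in> {1, -1} \<and> 0 \<le> s * y \<and> 0 \<le> t * z \<and>
    2 * (s * y) \<le> 2 * h + s * (t - 1) \<and> 2 * (t * z) \<le> 2 * h + t * (- s - 1) \<and>
    (w \<ge> 2 \<longrightarrow> bump_diff 1 (- 1) y \<le> 3 * s + 1 \<and> bump_diff 1 (- 1) z \<le> 3 * t + 1)"

lemma ex_triangle_signs:
  assumes h: "0 < h" and w: "0 \<le> w"
    and y: "6 * y \<le> 6 * h + (bump_diff 2 1 w + bump_diff 1 (- 1) z)"
      "6 * - y \<le> 6 * h + (bump_diff 2 1 (- w) + bump_diff 1 (- 1) (- z))"
    and z: "6 * z \<le> 6 * h + (bump_diff 1 1 y + bump_diff 2 1 w)"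
      "6 * - z \<le> 6 * h + (bump_diff 1 1 (- y) + bump_diff 2 1 (- w))"
  shows "\<exists>s t. triangle_signs h w y z s t"
proof -
  \<comment> \<open>a zero coordinate takes its sign in favour of the centre if \<open>w \<ge> 2\<close>, and in favour of the other
    vertex otherwise\<close>
  define s t :: int
    where "s = (if y > 0 \<or> y = 0 \<and> w \<ge> 2 then 1 else -1)" and "t = (if z \<ge> 0 then 1 else -1)"
  note diffs = bump_diff_1 bump_diff_minus_1
  have signs: "s \<in> {1, -1}" "t \<in> {1, -1}" and nonneg: "0 \<le> s * y" "0 \<le> t * z"
    by (auto simp: s_def t_def)
  have "bump_diff 2 1 w + bump_diff 1 (- 1) z \<le> 3 * (t - 1) + 5"
    "bump_diff 2 1 (- w) + bump_diff 1 (- 1) (- z) \<le> - 3 * (t - 1) + 5"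
    using w by (simp_all add: t_def diffs)
  then have "2 * (s * y) \<le> 2 * h + s * (t - 1)"
    using y h signs by (intro double_sign_mult_le_of_six_mult_le) (auto simp: s_def)
  moreover have "bump_diff 1 1 y + bump_diff 2 1 w \<le> 3 * (- s - 1) + 5"
    "bump_diff 1 1 (- y) + bump_diff 2 1 (- w) \<le> - 3 * (- s - 1) + 5"
    using w by (simp_all add: s_def diffs)
  then have "2 * (t * z) \<le> 2 * h + t * (- s - 1)"
    using z h signs by (intro double_sign_mult_le_of_six_mult_le) (auto simp: t_def)
  moreover have "w \<ge> 2 \<longrightarrow> bump_diff 1 (- 1) y \<le> 3 * s + 1 \<and> bump_diff 1 (- 1) z \<le> 3 * t + 1"
    by (auto simp: s_def t_def diffs)
  ultimately show ?thesis
    using signs nonneg unfolding triangle_signs_def by blast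
qed

lemma ex_sign_box_bowtie_of_coordinate_bounds:
  fixes x :: "vertex \<Rightarrow> int"
  assumes h: "3 \<le> h" and centre: "0 \<le> x V4"
    and upper: "\<And>i. 6 * x i \<le>
      6 * h + (\<Sum>j\<in>UNIV. bump_diff (bowtie_weight j) (bowtie i j) (x j))"
    and lower: "\<And>i. 6 * - x i \<le>
      6 * h + (\<Sum>j\<in>UNIV. bump_diff (bowtie_weight j) (bowtie i j) (- x j))"
  shows "\<exists>s. in_sign_box h bowtie s x"
proof -
  have pos: "0 < h" using h by simp
  note sums = bowtie_weight_def bowtie_def sum_vertex bump_diff_0
  obtain s1 s5 where s15: "triangle_signs h (x V4) (x V1) (x V5) s1 s5"
    using ex_triangle_signs[OF pos centre, of "x V1" "x V5"]
      upper[of V1] lower[of V1] upper[of V5] lower[of V5] by (auto simp: sums)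
  obtain s2 s3 where s23: "triangle_signs h (x V4) (x V2) (x V3) s2 s3"
    using ex_triangle_signs[OF pos centre, of "x V2" "x V3"]
      upper[of V2] lower[of V2] upper[of V3] lower[of V3] by (auto simp: sums)
  note signs = s15[unfolded triangle_signs_def] s23[unfolded triangle_signs_def]
  have "2 * x V4 \<le> 2 * h + (s1 + s2 + s3 + s5)"
  proof (cases "x V4 \<ge> 2")
    case True
    then have "6 * x V4 \<le> 6 * h + 3 * (s1 + s2 + s3 + s5) + 4"
      using signs upper[of V4] by (simp add: sums)
    moreover have "even (s1 + s2 + s3 + s5)"
      using signs by auto
    ultimately show ?thesis by presburger
  next
    case False
    with h signs show ?thesis by auto
  qed
  then have "in_sign_box h bowtie (vec5 s1 s2 s3 1 s5) x"
    using signs centre by (simp add: in_sign_box_iff all_vertex sum_vertex bowtie_def algebra_simps)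
  then show ?thesis by blast
qed

theorem twisted_bcc_lattice_bowtie_covering:
  fixes x :: "vertex \<Rightarrow> int"
  assumes h: "3 \<le> h" and k: "5 * h \<le> 2 * k + 1"
  shows "\<exists>v\<in>twisted_bcc_lattice h bowtie. l1_norm (x - v) \<le> k"
proof -
  have weight: "0 < bowtie_weight i" "bowtie_weight i \<le> 3"
    "3 * abs_row_sum bowtie i + bowtie_weight i < 6 * h" for i
    using h by (cases i; simp add: bowtie_weight_def abs_row_sum_bowtie)+
  have pos: "0 < h" using h by simp
  obtain y d where y: "y = x - edge_combination h bowtie d" and bounds:
    "\<And>i. 6 * y i \<le> 6 * h + (\<Sum>j\<in>UNIV. bump_diff (bowtie_weight j) (bowtie i j) (y j))"
    "\<And>i. 6 * - y i \<le> 6 * h + (\<Sum>j\<in>UNIV. bump_diff (bowtie_weight j) (bowtie i j) (- y j))"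
    using ex_translate_coordinate_bounds[OF antisymmetric_bowtie pos weight] by blast
  have "\<exists>s. in_sign_box h bowtie s y"
  proof (cases "0 \<le> y V4")
    case True
    then show ?thesis
      using bounds by (rule ex_sign_box_bowtie_of_coordinate_bounds[OF h])
  next
    case False
    then have "\<exists>s. in_sign_box h bowtie s (- y)"
      using bounds by (intro ex_sign_box_bowtie_of_coordinate_bounds[OF h]) simp_all
    then show ?thesis
      using in_sign_box_uminus by blast
  qed
  then obtain s where "in_sign_box h bowtie s (x - edge_combination h bowtie d)"
    unfolding y ..
  moreover have "even (abs_row_sum bowtie i)" for i
    by (cases i) (simp_all add: abs_row_sum_bowtie)
  ultimately show ?thesis
    using ex_lattice_point_near_sign_box[OF antisymmetric_bowtie] k
    by (simp add: card_vertex mult.commute)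
qed

section \<open>Distances in circulant graphs\<close>

definition weighted_sum :: "('i::finite \<Rightarrow> int) \<Rightarrow> ('i \<Rightarrow> int) \<Rightarrow> int" where
  "weighted_sum g x = (\<Sum>i\<in>UNIV. x i * g i)"

lemma weighted_sum_diff: "weighted_sum g (x - y) = weighted_sum g x - weighted_sum g y"
  by (simp add: weighted_sum_def left_diff_distrib sum_subtractf)

lemma weighted_sum_fun_upd: "weighted_sum g (x(i := a)) = weighted_sum g x + (a - x i) * g i"
  by (simp add: weighted_sum_def sum.remove[of UNIV i] left_diff_distrib)

lemma l1_norm_fun_upd: "l1_norm (x(i := a)) = l1_norm x + \<bar>a\<bar> - \<bar>x i\<bar>"
  by (simp add: l1_norm_def sum.remove[of UNIV i])

lemma l1_norm_nonneg: "0 \<le> l1_norm x"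
  by (simp add: l1_norm_def sum_nonneg)

lemma l1_norm_eq_0_iff: "l1_norm x = 0 \<longleftrightarrow> x = (\<lambda>_. 0)"
  by (auto simp: l1_norm_def sum_nonneg_eq_0_iff)

lemma arcs_circulant_graph_range_iff:
  "(u, w) \<in> arcs (circulant_graph n (range g)) \<longleftrightarrow>
    u \<in> {0..<n} \<and> w \<in> {0..<n} \<and> (\<exists>i. \<exists>e\<in>{1, -1}. [w - u = e * g i] (mod n))"
  by (auto simp: circulant_graph_def)

lemma circulant_graph_simps:
  "verts (circulant_graph n S) = {0..<n}" "tail (circulant_graph n S) = fst"
  "head (circulant_graph n S) = snd"
  by (simp_all add: circulant_graph_def)

lemma awalk_circulant_graph_simps:
  "pre_digraph.awalk (circulant_graph n S) u [] v \<longleftrightarrow> u = v \<and> u \<in> {0..<n}"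
  "pre_digraph.awalk (circulant_graph n S) u ((a, b) # p) v \<longleftrightarrow>
    (a, b) \<in> arcs (circulant_graph n S) \<and> u = a \<and> pre_digraph.awalk (circulant_graph n S) b p v"
proof -
  interpret pseudo_graph "circulant_graph n S"
    by (rule pseudo_graph_circulant_graph)
  show "awalk u [] v \<longleftrightarrow> u = v \<and> u \<in> {0..<n}"
    "awalk u ((a, b) # p) v \<longleftrightarrow> (a, b) \<in> arcs (circulant_graph n S) \<and> u = a \<and> awalk b p v"
    by (simp_all add: awalk_simps circulant_graph_simps)
qed

lemma weighted_sum_of_awalk:
  fixes g :: "'i::finite \<Rightarrow> int"
  assumes "pre_digraph.awalk (circulant_graph n (range g)) u p v"
  shows "\<exists>x. [weighted_sum g x = v - u] (mod n) \<and> l1_norm x \<le> int (length p)"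
  using assms
proof (induction p arbitrary: u)
  case Nil
  then have "u = v"
    by (simp add: awalk_circulant_graph_simps)
  then show ?case
    by (intro exI[of _ "\<lambda>_. 0"]) (simp add: weighted_sum_def l1_norm_def)
next
  case (Cons a p)
  obtain w where "(u, w) \<in> arcs (circulant_graph n (range g))"
    and p: "pre_digraph.awalk (circulant_graph n (range g)) w p v"
    using Cons.prems by (cases a) (auto simp: awalk_circulant_graph_simps)
  then obtain i e where e: "e \<in> {1, -1}" and step: "[w - u = e * g i] (mod n)"
    unfolding arcs_circulant_graph_range_iff by blast
  obtain x where x: "[weighted_sum g x = v - w] (mod n)" "l1_norm x \<le> int (length p)"
    using Cons.IH[OF p] by blast
  have "[weighted_sum g x + e * g i = (v - w) + (w - u)] (mod n)"
    using cong_add[OF x(1) cong_sym[OF step]] .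
  then have "[weighted_sum g (x(i := x i + e)) = v - u] (mod n)"
    by (simp add: weighted_sum_fun_upd)
  moreover have "l1_norm (x(i := x i + e)) \<le> int (length (a # p))"
    using x(2) e by (auto simp: l1_norm_fun_upd)
  ultimately show ?case by blast
qed

lemma awalk_of_weighted_sum:
  fixes g :: "'i::finite \<Rightarrow> int"
  assumes "0 < n" "u \<in> {0..<n}" "v \<in> {0..<n}" and "[weighted_sum g x = v - u] (mod n)"
  shows "\<exists>p. pre_digraph.awalk (circulant_graph n (range g)) u p v \<and> int (length p) = l1_norm x"
  using assms
proof (induction "nat (l1_norm x)" arbitrary: x u)
  case 0
  then have x: "x = (\<lambda>_. 0)"
    using l1_norm_nonneg[of x] l1_norm_eq_0_iff[of x] by simp
  then have "[v = u] (mod n)"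
    using 0(5) by (simp add: weighted_sum_def cong_iff_dvd_diff dvd_diff_commute)
  then have "u = v"
    using 0(3,4) by (simp add: cong_def)
  then show ?case
    using x 0(3) by (intro exI[of _ "[]"]) (simp add: l1_norm_def awalk_circulant_graph_simps)
next
  case (Suc l)
  then have "l1_norm x \<noteq> 0" by simp
  then obtain i where "x i \<noteq> 0"
    unfolding l1_norm_eq_0_iff by blast
  define e y w where "e = sgn (x i)" and "y = x(i := x i - e)" and "w = (u + e * g i) mod n"
  have e: "e \<in> {1, -1}" and norm_y: "l1_norm y = l1_norm x - 1"
    using \<open>x i \<noteq> 0\<close> by (auto simp: e_def y_def l1_norm_fun_upd sgn_if)
  have w: "w \<in> {0..<n}" "[w = u + e * g i] (mod n)"
    using Suc.prems(1) by (simp_all add: w_def cong_def)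
  have step: "[w - u = e * g i] (mod n)"
    using cong_diff[OF w(2) cong_refl[of u]] by simp
  have "[weighted_sum g y = v - w] (mod n)"
    using cong_diff[OF Suc.prems(4) cong_sym[OF step]] by (simp add: y_def weighted_sum_fun_upd)
  moreover have "l = nat (l1_norm y)"
    using Suc.hyps(2) norm_y by simp
  ultimately obtain p where p: "pre_digraph.awalk (circulant_graph n (range g)) w p v"
      "int (length p) = l1_norm y"
    using Suc.hyps(1) Suc.prems(1,3) w(1) by blast
  have "(u, w) \<in> arcs (circulant_graph n (range g))"
    unfolding arcs_circulant_graph_range_iff using Suc.prems(2) w(1) step e by blast
  then show ?case
    using p norm_y by (intro exI[of _ "(u, w) # p"]) (simp add: awalk_circulant_graph_simps)
qed

theorem graph_dist_circulant_graph:
  fixes g :: "'i::finite \<Rightarrow> int"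
  assumes "n > 0" "u \<in> {0..<n}" "v \<in> {0..<n}"
  shows "graph_dist (circulant_graph n (range g)) u v =
    (INF x\<in>{x. [weighted_sum g x = v - u] (mod n)}. ereal (real_of_int (l1_norm x)))"
    (is "_ = (INF x\<in>?X. _)")
proof -
  interpret pseudo_graph "circulant_graph n (range g)"
    by (rule pseudo_graph_circulant_graph)
  have dist: "graph_dist (circulant_graph n (range g)) u v =
      (INF p\<in>{p. awalk u p v}. ereal (real (length p)))"
    by (simp add: graph_dist_def \<mu>_def awalk_cost_def sum_list_triv)
  show ?thesis
    unfolding dist
  proof (rule antisym)
    show "(INF p\<in>{p. awalk u p v}. ereal (real (length p))) \<le>
        (INF x\<in>?X. ereal (real_of_int (l1_norm x)))"
    proof (rule INF_mono)
      fix x assume "x \<in> ?X"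
      then obtain p where "awalk u p v" "int (length p) = l1_norm x"
        using awalk_of_weighted_sum[OF assms] by blast
      then show "\<exists>p\<in>{p. awalk u p v}. ereal (real (length p)) \<le> ereal (real_of_int (l1_norm x))"
        by (intro bexI[of _ p]) simp_all
    qed
    show "(INF x\<in>?X. ereal (real_of_int (l1_norm x))) \<le>
        (INF p\<in>{p. awalk u p v}. ereal (real (length p)))"
    proof (rule INF_mono)
      fix p assume "p \<in> {p. awalk u p v}"
      then obtain x where "x \<in> ?X" "l1_norm x \<le> int (length p)"
        using weighted_sum_of_awalk by blast
      then show "\<exists>x\<in>?X. ereal (real_of_int (l1_norm x)) \<le> ereal (real (length p))"
        by (intro bexI[of _ x]) simp_all
    qed
  qed
qed

lemma diameter_circulant_graph_eqI:
  fixes g :: "'i::finite \<Rightarrow> int" and k :: int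
  assumes n: "n > 0"
    and upper: "\<And>r. \<exists>x. [weighted_sum g x = r] (mod n) \<and> l1_norm x \<le> k"
    and lower: "\<And>x. [weighted_sum g x = r] (mod n) \<Longrightarrow> k \<le> l1_norm x"
  shows "diameter (circulant_graph n (range g)) = ereal (real_of_int k)"
proof -
  have "graph_dist (circulant_graph n (range g)) u v \<le> ereal (real_of_int k)"
    if "u \<in> {0..<n}" "v \<in> {0..<n}" for u v
  proof -
    obtain x where "[weighted_sum g x = v - u] (mod n)" "l1_norm x \<le> k"
      using upper by blast
    then show ?thesis
      unfolding graph_dist_circulant_graph[OF n that] by (intro INF_lower2[of x]) simp_all
  qed
  moreover have "ereal (real_of_int k) \<le> graph_dist (circulant_graph n (range g)) 0 (r mod n)"
    using n lower by (simp add: graph_dist_circulant_graph le_INF_iff cong_def)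
  ultimately show ?thesis
    unfolding diameter_def circulant_graph_simps using n
    by (intro antisym SUP_least SUP_upper2[of "(0, r mod n)"]) auto
qed

section \<open>The lattice of the circulant graph\<close>

text \<open>The order and the generators as polynomials in \<open>q = h / 3 = (2 k + 1) / 15\<close>.\<close>

definition circ_order :: "int \<Rightarrow> int" where
  "circ_order q = 3 * q * (36 * q\<^sup>2 + 1) * (36 * q\<^sup>2 + 5)"

definition circ_gen2 :: "int \<Rightarrow> int" where
  "circ_gen2 q = 648 * q ^ 4 + 90 * q\<^sup>2 + 1"

definition circ_gen4 :: "int \<Rightarrow> int" where
  "circ_gen4 q = (6 * q - 1) * (36 * q\<^sup>2 + 1) * (6 * q\<^sup>2 + 1)"

definition circ_gen :: "int \<Rightarrow> vertex \<Rightarrow> int" where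
  "circ_gen q = vec5 1 (circ_gen2 q) (circ_gen4 q - 9 * q * (12 * q\<^sup>2 + 1)) (circ_gen4 q)
    (circ_gen4 q + 6 * q)"

lemmas circ_defs = circ_order_def circ_gen2_def circ_gen4_def circ_gen_def

lemma dvd_weighted_sum_if_twisted_bcc_lattice:
  assumes "v \<in> twisted_bcc_lattice (3 * q) bowtie"
  shows "circ_order q dvd weighted_sum (circ_gen q) v"
proof -
  obtain s where parity: "\<And>i j. even (s i - s j)"
    and v: "\<And>i. 2 * v i = edge_combination (3 * q) bowtie s i"
    using assms by (auto simp: twisted_bcc_lattice_def)
  have "even (s V2 + s V4)"
    using parity[of V2 V4] by simp
  then obtain c where c: "s V2 + s V4 = 2 * c" ..
  have "2 * weighted_sum (circ_gen q) v =
      (\<Sum>i\<in>UNIV. edge_combination (3 * q) bowtie s i * circ_gen q i)"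
    by (simp add: weighted_sum_def sum_distrib_left v[symmetric] mult.assoc)
  also have "\<dots> = circ_order q * (s V2 + 2 * q * s V3 + (2 * q - 1) * s V4 + 2 * q * s V5)"
    by (simp add: edge_combination_def sum_vertex bowtie_def circ_defs) algebra
  also have "\<dots> = 2 * (circ_order q * (c + q * s V3 + (q - 1) * s V4 + q * s V5))"
    using c by algebra
  finally show ?thesis by simp
qed

lemma twisted_bcc_lattice_if_dvd_weighted_sum:
  assumes "circ_order q dvd weighted_sum (circ_gen q) x"
  shows "x \<in> twisted_bcc_lattice (3 * q) bowtie"
proof -
  obtain z where z: "weighted_sum (circ_gen q) x = circ_order q * z"
    using assms ..
  define y2 y4 u where "y2 = x V2 + 6 * q * x V3" and "y4 = x V3 + x V4 + x V5" and "u = z + x V3"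
  have x1: "x V1 = circ_order q * u - circ_gen2 q * y2 - circ_gen4 q * y4 - 6 * q * x V5"
    using z by (simp add: weighted_sum_def sum_vertex circ_defs y2_def y4_def u_def) algebra
  \<comment> \<open>The first two rows of \<open>E\<close> reduce \<open>e\<^sub>5\<close> to \<open>e\<^sub>4 + 6 q e\<^sub>1\<close> and \<open>e\<^sub>3\<close> to \<open>6 q e\<^sub>2 + e\<^sub>4\<close> modulo \<open>L\<close>. The
    factors of \<open>u\<close>, \<open>y2\<close>, \<open>y4\<close> are the solutions \<open>s\<close> of \<open>s E = 2 n e\<^sub>1\<close>, \<open>s E = 2 (e\<^sub>2 - g\<^sub>2 e\<^sub>1)\<close> and
    \<open>s E = 2 (e\<^sub>4 - g\<^sub>4 e\<^sub>1)\<close>.\<close>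
  define s where "s = vec5
    ((1296 * q ^ 4 + 144 * q\<^sup>2 + 1) * u - 18 * q * (12 * q\<^sup>2 + 1) * y2
      - 2 * q * (216 * q ^ 3 - 36 * q\<^sup>2 + 30 * q - 5) * y4 - 2 * x V5)
    ((1 - 36 * q\<^sup>2) * u + 6 * q * y2 + 2 * q * (6 * q - 1) * y4 - 2 * x V3)
    (- (6 * q + 1)\<^sup>2 * u + (6 * q + 2) * y2 + 2 * q * (6 * q + 1) * y4)
    (- (6 * q + 1) * (36 * q\<^sup>2 + 1) * u + 6 * q * (6 * q + 1) * y2 + 2 * q * (36 * q\<^sup>2 + 1) * y4)
    ((216 * q ^ 3 - 36 * q\<^sup>2 + 18 * q - 1) * u - 2 * (18 * q\<^sup>2 - 3 * q + 1) * y2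
      + 2 * (1 - 5 * q + 12 * q\<^sup>2 - 36 * q ^ 3) * y4)"
  have "\<forall>i. 2 * x i = edge_combination (3 * q) bowtie s i"
    unfolding all_vertex
    by (simp_all add: edge_combination_def sum_vertex bowtie_def s_def x1 circ_defs y2_def y4_def) algebra+
  moreover have "\<forall>i j. even (s i - s j)"
    by (simp add: all_vertex s_def)
  ultimately show ?thesis
    unfolding twisted_bcc_lattice_def by blast
qed

theorem dvd_weighted_sum_iff_twisted_bcc_lattice:
  "circ_order q dvd weighted_sum (circ_gen q) x \<longleftrightarrow> x \<in> twisted_bcc_lattice (3 * q) bowtie"
  using dvd_weighted_sum_if_twisted_bcc_lattice twisted_bcc_lattice_if_dvd_weighted_sum by blast

lemma strict_sorted_circ_gen:
  assumes "1 \<le> q"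
  shows "sorted_wrt (<)
    [circ_gen q V1, circ_gen q V2, circ_gen q V3, circ_gen q V4, circ_gen q V5, circ_order q]"
proof -
  obtain p where "q = p + 1" "0 \<le> p"
    using assms by (intro that[of "q - 1"]) simp_all
  then show ?thesis
    by (auto simp: sorted_wrt2 circ_defs algebra_simps power_numeral_reduce
        intro!: add_pos_nonneg add_nonneg_nonneg mult_nonneg_nonneg)
qed

lemma circ_gen_1: "circ_gen q V1 = 1"
  by (simp add: circ_gen_def)

lemma circ_gen_covering:
  assumes q: "1 \<le> q" and k: "2 * k + 1 = 15 * q"
  shows "\<exists>x. [weighted_sum (circ_gen q) x = r] (mod circ_order q) \<and> l1_norm x \<le> k"
proof -
  define x where "x = vec5 r 0 0 0 0"
  have x: "weighted_sum (circ_gen q) x = r"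
    by (simp add: weighted_sum_def sum_vertex x_def circ_gen_1)
  obtain v where v: "v \<in> twisted_bcc_lattice (3 * q) bowtie" "l1_norm (x - v) \<le> k"
    using twisted_bcc_lattice_bowtie_covering[of "3 * q" k x] q k by auto
  then have "[weighted_sum (circ_gen q) (x - v) = r] (mod circ_order q)"
    by (simp add: weighted_sum_diff x cong_iff_dvd_diff dvd_weighted_sum_iff_twisted_bcc_lattice)
  with v(2) show ?thesis by blast
qed

lemma ex_far_residue_circ_gen:
  assumes q: "1 \<le> q" and k: "2 * k + 1 = 15 * q"
  shows "\<exists>r. \<forall>x. [weighted_sum (circ_gen q) x = r] (mod circ_order q) \<longrightarrow> k \<le> l1_norm x"
proof -
  define t where "t = (3 * q - 1) div 2"
  define w where "w = vec5 (t + 1) (t + 1) t t t"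
  have t: "3 * q = 2 * t + 1" "1 \<le> t"
    using q k unfolding t_def by presburger+
  then have norm_w: "l1_norm w = k"
    using k by (simp add: l1_norm_def sum_vertex w_def)
  have small: "2 * \<bar>w i\<bar> + abs_row_sum bowtie i \<le> 2 * (3 * q)" for i
    using t by (cases i) (simp_all add: w_def abs_row_sum_bowtie)
  have "k \<le> l1_norm x"
    if "[weighted_sum (circ_gen q) x = weighted_sum (circ_gen q) w] (mod circ_order q)" for x
  proof -
    have "w - x \<in> twisted_bcc_lattice (3 * q) bowtie"
      using that
      by (simp add: dvd_weighted_sum_iff_twisted_bcc_lattice[symmetric] weighted_sum_diff
          cong_iff_dvd_diff dvd_diff_commute)
    then have "l1_norm w \<le> l1_norm (w - (w - x))"
      using k norm_w
      by (intro l1_norm_le_l1_norm_diff_twisted_bcc_lattice[OF antisymmetric_bowtie small])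
        (simp_all add: card_vertex)
    then show ?thesis
      by (simp add: norm_w)
  qed
  then show ?thesis by blast
qed

theorem diameter_circulant_graph_circ_gen:
  assumes q: "1 \<le> q" and k: "2 * k + 1 = 15 * q"
  shows "diameter (circulant_graph (circ_order q) (range (circ_gen q))) = ereal (real_of_int k)"
proof -
  obtain r where "\<And>x. [weighted_sum (circ_gen q) x = r] (mod circ_order q) \<Longrightarrow> k \<le> l1_norm x"
    using ex_far_residue_circ_gen[OF q k] by blast
  moreover have "0 < circ_order q"
    using strict_sorted_circ_gen[OF q] circ_gen_1[of q] by simp
  ultimately show ?thesis
    using circ_gen_covering[OF q k] by (intro diameter_circulant_graph_eqI)
qed

lemma of_int_circ_order_circ_gen:
  fixes k q :: int
  assumes "2 * k + 1 = 15 * q"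
  shows "rat_of_int (circ_order q) = L_CC_10 (rat_of_int k) \<and>
    rat_of_int (circ_gen q V2) = gen2 (rat_of_int k) \<and>
    rat_of_int (circ_gen q V3) = gen3 (rat_of_int k) \<and>
    rat_of_int (circ_gen q V4) = gen4 (rat_of_int k) \<and>
    rat_of_int (circ_gen q V5) = gen5 (rat_of_int k)"
proof -
  have "rat_of_int (2 * k + 1) = rat_of_int (15 * q)"
    by (simp only: assms)
  then have k: "rat_of_int k = (15 * rat_of_int q - 1) / 2"
    by simp
  show ?thesis
    unfolding k circ_defs L_CC_10_def gen2_def gen3_def gen4_def gen5_def
    by (simp add: field_simps; intro conjI; algebra)
qed

theorem theorem6:
  fixes k :: int
  assumes "k > 0" and "[k = 7] (mod 15)"
  shows "\<exists>n::int. n > 0 \<and> rat_of_int n = L_CC_10 (rat_of_int k) \<and>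
    (\<exists>S. S \<subseteq> {0..<n} \<and> card S = 5 \<and>
         diameter (circulant_graph n S) = ereal (real_of_int k)) \<and>
    (\<exists>g1 g2 g3 g4 g5 :: int.
         g1 = 1 \<and>
         rat_of_int g2 = gen2 (rat_of_int k) \<and>
         rat_of_int g3 = gen3 (rat_of_int k) \<and>
         rat_of_int g4 = gen4 (rat_of_int k) \<and>
         rat_of_int g5 = gen5 (rat_of_int k) \<and>
         card ((\<lambda>g. g mod n) ` {g1, g2, g3, g4, g5}) = 5 \<and>
         diameter (circulant_graph n ((\<lambda>g. g mod n) ` {g1, g2, g3, g4, g5})) = ereal (real_of_int k))"
proof -
  have "k mod 15 = 7"
    using assms(2) by (simp add: cong_def)
  then obtain q where k: "2 * k + 1 = 15 * q" and q: "1 \<le> q"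
    using assms(1) by (intro that[of "2 * (k div 15) + 1"]) presburger+
  let ?n = "circ_order q" and ?g = "circ_gen q"
  note sorted = strict_sorted_circ_gen[OF q] circ_gen_1[of q]
  have n: "0 < ?n" and S: "range ?g \<subseteq> {0..<?n}" "card (range ?g) = 5"
    using sorted by (auto simp: range_vertex)
  have "g mod ?n = g" if "g \<in> range ?g" for g
    using subsetD[OF S(1) that] by simp
  then have "(\<lambda>g. g mod ?n) ` {?g V1, ?g V2, ?g V3, ?g V4, ?g V5} = range ?g"
    unfolding range_vertex[symmetric] by (simp cong: image_cong)
  then show ?thesis
    using n S diameter_circulant_graph_circ_gen[OF q k] of_int_circ_order_circ_gen[OF k] circ_gen_1[of q]
    by metis
qed

end
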